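(* Let ${\mathbf{x}}^* \in \mathbb{R}^n$, ${\mathbf{x}}^* \geq 0$, with $\mathcal{J} = \mathrm{supp}({\mathbf{x}}^* )$, and assume there is a vector ${\mathbf{c}}$ with $$\frac{P {\mathbf{e}}_j}{\| P {\mathbf{e}}_j \|_2} \cdot {\mathbf{c}} = 1 \ \ \forall j \in \mathcal{J}, \qquad \frac{P {\mathbf{e}}_i}{\| P {\mathbf{e}}_i \|_2} \cdot {\mathbf{c}} < 1 \ \ \forall i \in \mathcal{J}^c.$$ Let $s \in [\|{\mathbf{x}}^*\|_\infty, \infty]$. If $A$ is injective on the set $\{ {\mathbf{z}} \in \mathbb{R}^n : \mathrm{supp}({\mathbf{z}}) \subseteq \mathcal{J},\ 0 \leq {\mathbf{z}} \leq s \}$, then ${\mathbf{x}}^*$ is the unique solution of $$\min_{0 \leq {\mathbf{x}} \leq s} \| W {\mathbf{x}} \|_1 \quad \text{subject to} \quad A {\mathbf{x}} = A {\mathbf{x}}^*.$$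
   Context: $A \in \mathbb{R}^{m\times n}$ is a matrix, $A^\dagger$ its Moore–Penrose pseudoinverse, and $P = A^\dagger A$ the orthogonal projection onto $\mathcal{N}(A)^\perp$. ${\mathbf{e}}_1,\dots,{\mathbf{e}}_n$ are the standard unit vectors, assumed not to lie in $\mathcal{N}(A)$, so $w_i := \|P{\mathbf{e}}_i\|_2 > 0$; $W = \mathrm{diag}(w_1,\dots,w_n)$. Inequalities between vectors and scalars are componentwise; $s=\infty$ means only the constraint ${\mathbf{x}}\ge 0$. *)

theory Defs
  imports "HOL-Analysis.Analysis" "HOL-Library.Extended_Real"
begin

text \<open>Moore--Penrose pseudoinverse, defined by the four Penrose conditions.\<close>
definition is_pinv :: "real^'n^'m \<Rightarrow> real^'m^'n \<Rightarrow> bool" where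
  "is_pinv A X \<longleftrightarrow> A ** X ** A = A \<and> X ** A ** X = X \<and>
     transpose (A ** X) = A ** X \<and> transpose (X ** A) = X ** A"

definition pinv :: "real^'n^'m \<Rightarrow> real^'m^'n" where
  "pinv A = (THE X. is_pinv A X)"

text \<open>P = A^+ A, orthogonal projection onto the orthogonal complement of the null space.\<close>
definition projP :: "real^'n^'m \<Rightarrow> real^'n^'n" where
  "projP A = pinv A ** A"

text \<open>Weights w_i = norm (P e_i).\<close>
definition wt :: "real^'n^'m \<Rightarrow> 'n \<Rightarrow> real" where
  "wt A i = norm (projP A *v axis i 1)"

definition supp :: "real^'n \<Rightarrow> 'n set" where
  "supp x = {i. x $ i \<noteq> 0}"

text \<open>Box constraint 0 <= x <= s, with s = \<infinity> meaning only x >= 0.\<close>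
definition box :: "ereal \<Rightarrow> (real^'n) set" where
  "box s = {x. \<forall>i. 0 \<le> x $ i \<and> ereal (x $ i) \<le> s}"

text \<open>Weighted l1 objective, norm (W x)_1.\<close>
definition wl1 :: "real^'n^'m \<Rightarrow> real^'n \<Rightarrow> real" where
  "wl1 A x = (\<Sum>i\<in>UNIV. \<bar>wt A i * x $ i\<bar>)"

definition supnorm :: "real^'n \<Rightarrow> real" where
  "supnorm x = Max (range (\<lambda>i. \<bar>x $ i\<bar>))"

end

theory Submission
  imports Defs
begin

text \<open>
  The vector \<open>c\<close> is a dual certificate. Put \<open>d\<^sub>i = P e\<^sub>i \<bullet> c\<close>; the hypotheses say
  \<open>d\<^sub>i = w\<^sub>i\<close> on the support of \<open>x*\<close> and \<open>d\<^sub>i < w\<^sub>i\<close> off it. For \<open>x \<ge> 0\<close> we have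
  \<open>\<Sum>\<^sub>i x\<^sub>i d\<^sub>i = P x \<bullet> c\<close>, and \<open>P x = A\<^sup>\<dagger> A x\<close> depends only on \<open>A x\<close>. Hence every feasible \<open>x\<close>
  satisfies \<open>\<parallel>W x\<parallel>\<^sub>1 = \<parallel>W x*\<parallel>\<^sub>1 + \<Sum>\<^sub>i x\<^sub>i (w\<^sub>i - d\<^sub>i)\<close> with a nonnegative gap, which vanishes only
  if \<open>x\<close> is supported in the support of \<open>x*\<close>; injectivity of \<open>A\<close> there gives \<open>x = x*\<close>.
  That the pseudoinverse is well defined is proved by building it from the orthogonal
  projections onto the kernel and the range of \<open>A\<close>.
\<close>

definition orthogonal_projection :: "'a::real_inner set \<Rightarrow> ('a \<Rightarrow> 'a) \<Rightarrow> bool" where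
  "orthogonal_projection S p \<longleftrightarrow> (\<forall>x. p x \<in> S \<and> (\<forall>y\<in>S. orthogonal (x - p x) y))"

lemma orthogonal_projection_exists:
  fixes S :: "'a::euclidean_space set"
  assumes "subspace S"
  obtains p where "linear p" "orthogonal_projection S p"
proof -
  obtain B where "B \<subseteq> S" "pairwise orthogonal B" "span B = S"
    using orthogonal_basis_subspace[OF assms] by metis
  define p where "p x = (\<Sum>b\<in>B. (b \<bullet> x / (b \<bullet> b)) *\<^sub>R b)" for x
  have "linear p"
    by (rule linearI)
      (simp_all add: p_def inner_add_right add_divide_distrib scaleR_add_left sum.distrib scaleR_sum_right)
  have "p x \<in> S" for x
    using \<open>B \<subseteq> S\<close> assms unfolding p_def by (auto intro: subspace_sum subspace_scale)
  moreover have "orthogonal (x - p x) y" if "y \<in> S" for x y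
    using Gram_Schmidt_step[OF \<open>pairwise orthogonal B\<close>, of y x] that \<open>span B = S\<close>
    by (simp add: p_def orthogonal_commute)
  ultimately have "orthogonal_projection S p"
    by (simp add: orthogonal_projection_def)
  with \<open>linear p\<close> show thesis by (rule that)
qed

lemma orthogonal_projection_fixes:
  assumes "subspace S" "orthogonal_projection S p" "y \<in> S"
  shows "p y = y"
proof -
  have "y - p y \<in> S" "orthogonal (y - p y) (y - p y)"
    using assms by (auto simp: orthogonal_projection_def subspace_diff)
  then show ?thesis by (simp add: orthogonal_self)
qed

lemma orthogonal_projection_self_adjoint:
  assumes "orthogonal_projection S p"
  shows "p x \<bullet> y = x \<bullet> p y"
proof -
  have "(x - p x) \<bullet> p y = 0" "(y - p y) \<bullet> p x = 0"
    using assms by (auto simp: orthogonal_projection_def orthogonal_def)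
  then show ?thesis by (simp add: inner_diff_left inner_diff_right inner_commute)
qed

lemma transpose_eq_if_self_adjoint:
  fixes M :: "real^'n^'n"
  assumes "\<And>x y. (M *v x) \<bullet> y = x \<bullet> (M *v y)"
  shows "transpose M = M"
proof -
  have "(*v) (transpose M) = (*v) M"
    using adjoint_matrix[of M] adjoint_unique[of "(*v) M" "(*v) M"] assms by metis
  then show ?thesis by (metis matrix_of_matrix_vector_mul)
qed

lemma is_pinv_unique:
  assumes X: "is_pinv A X" and Y: "is_pinv A Y"
  shows "X = Y"
proof -
  from X have x1: "A ** X ** A = A" and x2: "X ** A ** X = X" and x3: "transpose (A ** X) = A ** X"
    and x4: "transpose (X ** A) = X ** A" by (auto simp: is_pinv_def)
  from Y have y1: "A ** Y ** A = A" and y2: "Y ** A ** Y = Y" and y3: "transpose (A ** Y) = A ** Y"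
    and y4: "transpose (Y ** A) = Y ** A" by (auto simp: is_pinv_def)
  have "X = X ** (transpose X ** transpose (A ** Y ** A))"
    using x2 x3 y1 by (simp add: matrix_mul_assoc matrix_transpose_mul)
  also have "\<dots> = X ** A ** Y"
    using x1 x3 y3 by (simp add: matrix_transpose_mul matrix_mul_assoc)
  also have "\<dots> = (X ** A) ** (Y ** A) ** Y"
    using y2 by (metis matrix_mul_assoc)
  also have "\<dots> = (transpose (A ** X ** A) ** transpose Y) ** Y"
    using x4 y4 by (metis matrix_transpose_mul matrix_mul_assoc)
  also have "\<dots> = Y"
    using x1 y2 y4 by (simp add: matrix_transpose_mul matrix_mul_assoc)
  finally show ?thesis .
qed

lemma left_inverse_modulo_kernel:
  fixes A :: "real^'n^'m"
  assumes q: "orthogonal_projection {x. A *v x = 0} q"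
  obtains g where "linear g" "\<And>x. g (A *v x) = x - q x"
proof -
  define N where "N = {x. A *v x = 0}"
  define R where "R = {r. \<forall>n\<in>N. orthogonal n r}"
  have "span R = R"
    unfolding R_def by (simp add: span_eq_iff subspace_orthogonal_to_vectors)
  have "inj_on ((*v) A) (span R)"
  proof (rule inj_onI)
    fix r r' assume "r \<in> span R" "r' \<in> span R" "A *v r = A *v r'"
    then have "r - r' \<in> R" "r - r' \<in> N"
      using \<open>span R = R\<close> subspace_orthogonal_to_vectors[of N]
      by (auto simp: N_def R_def[symmetric] subspace_diff matrix_vector_mult_diff_distrib)
    then show "r = r'" by (auto simp: R_def orthogonal_self)
  qed
  then obtain g where "linear g" and g: "\<forall>r\<in>span R. g (A *v r) = r"
    using linear_inj_on_left_inverse[OF matrix_vector_mul_linear] by blast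
  have "g (A *v x) = x - q x" for x
  proof -
    have "q x \<in> N" "x - q x \<in> R"
      using q by (auto simp: orthogonal_projection_def N_def R_def orthogonal_commute)
    then have "A *v x = A *v (x - q x)"
      by (simp add: N_def matrix_vector_mult_diff_distrib)
    with \<open>x - q x \<in> R\<close> g show ?thesis by (simp add: span_base)
  qed
  with \<open>linear g\<close> show thesis by (rule that)
qed

lemma is_pinv_exists: "\<exists>X. is_pinv (A::real^'n^'m) X"
proof -
  have "subspace {x. A *v x = 0}"
    by (rule linear_subspace_kernel[OF matrix_vector_mul_linear])
  then obtain q where q: "orthogonal_projection {x. A *v x = 0} q"
    using orthogonal_projection_exists by blast
  obtain g where "linear g" and gA: "\<And>x. g (A *v x) = x - q x"
    using left_inverse_modulo_kernel[OF q] by metis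
  have "subspace (range ((*v) A))"
    by (rule linear_subspace_image[OF matrix_vector_mul_linear subspace_UNIV])
  then obtain p where "linear p" and p: "orthogonal_projection (range ((*v) A)) p"
    using orthogonal_projection_exists by blast
  have Ag: "A *v g (A *v x) = A *v x" for x
    using q by (auto simp: gA orthogonal_projection_def matrix_vector_mult_diff_distrib)
  \<comment> \<open>With \<open>X = g \<circ> p\<close>, both \<open>A X = p\<close> and \<open>X A = id - q\<close> are orthogonal projections, hence symmetric.\<close>
  define X where "X = matrix (g \<circ> p)"
  have X: "X *v y = g (p y)" for y
    unfolding X_def using linear_compose[OF \<open>linear p\<close> \<open>linear g\<close>] by (simp add: matrix_works)
  have pA: "p (A *v x) = A *v x" for x
    using p by (simp add: orthogonal_projection_fixes[OF \<open>subspace (range ((*v) A))\<close>])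
  have Agp: "A *v g (p y) = p y" for y
  proof -
    obtain x where "p y = A *v x" using p by (auto simp: orthogonal_projection_def)
    then show ?thesis by (simp add: Ag)
  qed
  have XA: "(X ** A) *v x = x - q x" for x
    by (simp add: X pA gA flip: matrix_vector_mul_assoc)
  have "A ** X ** A = A"
    by (simp add: matrix_eq X pA Ag flip: matrix_vector_mul_assoc)
  moreover have "X ** A ** X = X"
    using pA[of "g (p _)"] by (simp add: matrix_eq X Agp flip: matrix_vector_mul_assoc)
  moreover have "transpose (A ** X) = A ** X"
    using orthogonal_projection_self_adjoint[OF p]
    by (intro transpose_eq_if_self_adjoint) (simp add: X Agp flip: matrix_vector_mul_assoc)
  moreover have "transpose (X ** A) = X ** A"
    using orthogonal_projection_self_adjoint[OF q]
    by (intro transpose_eq_if_self_adjoint) (simp add: XA inner_diff_left inner_diff_right)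
  ultimately show ?thesis unfolding is_pinv_def by blast
qed

lemma is_pinv_pinv: "is_pinv A (pinv A)"
  unfolding pinv_def using is_pinv_exists is_pinv_unique by (metis theI)

lemma projP_apply: "projP A *v x = pinv A *v (A *v x)"
  by (simp add: projP_def matrix_vector_mul_assoc)

lemma projP_axis_nonzero:
  assumes "A *v axis i 1 \<noteq> 0"
  shows "projP A *v axis i 1 \<noteq> 0"
proof -
  have "A *v (projP A *v axis i 1) = A *v axis i 1"
    using is_pinv_pinv[of A]
    by (simp add: is_pinv_def projP_apply matrix_vector_mul_assoc matrix_mul_assoc)
  with assms show ?thesis by auto
qed

lemma wt_pos: "A *v axis i 1 \<noteq> 0 \<Longrightarrow> 0 < wt A i"
  by (simp add: wt_def projP_axis_nonzero)

lemma wl1_nonneg: "\<forall>i. 0 \<le> x $ i \<Longrightarrow> wl1 A x = (\<Sum>i\<in>UNIV. x $ i * wt A i)"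
  by (simp add: wl1_def wt_def abs_mult mult.commute)

lemma inner_matrix_vector_mult_axis:
  fixes M :: "real^'n^'k"
  shows "(M *v x) \<bullet> c = (\<Sum>i\<in>UNIV. x $ i * ((M *v axis i 1) \<bullet> c))"
proof -
  have "M *v x = (\<Sum>i\<in>UNIV. x $ i *\<^sub>R (M *v axis i 1))"
    by (subst basis_expansion[of x, symmetric])
      (simp add: linear_sum[OF matrix_vector_mul_linear] matrix_vector_mult_scaleR scalar_mult_eq_scaleR)
  then show ?thesis by (simp add: inner_sum_left)
qed

lemma box_if_supnorm_le:
  assumes "\<forall>i. 0 \<le> x $ i" "ereal (supnorm x) \<le> s"
  shows "x \<in> box s"
proof -
  have "x $ i \<le> supnorm x" for i
    unfolding supnorm_def by (rule order_trans[OF abs_ge_self Max_ge]) auto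
  then show ?thesis
    using assms by (auto simp: box_def intro: order_trans[OF _ assms(2)])
qed

lemma wl1_eq_certificate_gap:
  assumes x_nonneg: "\<forall>i. 0 \<le> x $ i" and xs_nonneg: "\<forall>i. 0 \<le> xs $ i"
    and same_data: "A *v x = A *v xs"
    and tight: "\<forall>j\<in>supp xs. (projP A *v axis j 1) \<bullet> c = wt A j"
  shows "wl1 A x = wl1 A xs + (\<Sum>i\<in>UNIV. x $ i * (wt A i - (projP A *v axis i 1) \<bullet> c))"
proof -
  have "wl1 A xs = (\<Sum>i\<in>UNIV. xs $ i * ((projP A *v axis i 1) \<bullet> c))"
    unfolding wl1_nonneg[OF xs_nonneg] using tight by (intro sum.cong) (auto simp: supp_def)
  also have "\<dots> = (projP A *v xs) \<bullet> c"
    by (rule inner_matrix_vector_mult_axis[symmetric])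
  also have "\<dots> = (\<Sum>i\<in>UNIV. x $ i * ((projP A *v axis i 1) \<bullet> c))"
    using same_data inner_matrix_vector_mult_axis[of "projP A" x c] by (simp add: projP_apply)
  finally show ?thesis
    by (simp add: wl1_nonneg[OF x_nonneg] algebra_simps sum_subtractf)
qed

lemma supp_subset_if_gap_sum_zero:
  fixes x :: "real^'n"
  assumes "\<forall>i. 0 \<le> x $ i" "\<forall>i. 0 \<le> gap i" "\<forall>i\<in>- J. 0 < gap i"
    and "(\<Sum>i\<in>UNIV. x $ i * gap i) = 0"
  shows "supp x \<subseteq> J"
proof -
  have "\<forall>i\<in>UNIV. x $ i * gap i = 0"
    using assms sum_nonneg_eq_0_iff[of UNIV "\<lambda>i. x $ i * gap i"] by simp
  then show ?thesis using assms(3) by (force simp: supp_def)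
qed

theorem corollary1:
  fixes A :: "real^'n^'m" and xs c :: "real^'n" and s :: ereal
  assumes not_null: "\<forall>i. A *v axis i 1 \<noteq> 0"
    and xs_nonneg: "\<forall>i. 0 \<le> xs $ i"
    and c_on: "\<forall>j\<in>supp xs. ((1 / wt A j) *\<^sub>R (projP A *v axis j 1)) \<bullet> c = 1"
    and c_off: "\<forall>i\<in>- supp xs. ((1 / wt A i) *\<^sub>R (projP A *v axis i 1)) \<bullet> c < 1"
    and s_ge: "ereal (supnorm xs) \<le> s"
    and inj: "inj_on (\<lambda>z. A *v z) {z. supp z \<subseteq> supp xs \<and> z \<in> box s}"
  shows "xs \<in> box s \<and>
         (\<forall>x. x \<in> box s \<and> A *v x = A *v xs \<longrightarrow> wl1 A xs \<le> wl1 A x) \<and>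
         (\<forall>x. x \<in> box s \<and> A *v x = A *v xs \<and> wl1 A x \<le> wl1 A xs \<longrightarrow> x = xs)"
proof -
  define gap where "gap i = wt A i - (projP A *v axis i 1) \<bullet> c" for i
  have "0 < wt A i" for i using not_null by (simp add: wt_pos)
  then have tight: "\<forall>j\<in>supp xs. gap j = 0" and slack: "\<forall>i\<in>- supp xs. 0 < gap i"
    using c_on c_off by (auto simp: gap_def field_simps)
  then have gap_nonneg: "0 \<le> gap i" for i by (metis ComplI order.refl less_imp_le)
  have xs_box: "xs \<in> box s" using xs_nonneg s_ge by (rule box_if_supnorm_le)
  have objective: "wl1 A x = wl1 A xs + (\<Sum>i\<in>UNIV. x $ i * gap i)"
    if "x \<in> box s" "A *v x = A *v xs" for x
    unfolding gap_def
    by (rule wl1_eq_certificate_gap) (use that xs_nonneg tight in \<open>auto simp: box_def gap_def\<close>)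
  have gap_sum_nonneg: "0 \<le> (\<Sum>i\<in>UNIV. x $ i * gap i)" if "x \<in> box s" for x
    using that gap_nonneg by (intro sum_nonneg) (simp add: box_def)
  show ?thesis
  proof (intro conjI allI impI)
    show "xs \<in> box s" by (rule xs_box)
  next
    fix x assume "x \<in> box s \<and> A *v x = A *v xs"
    then show "wl1 A xs \<le> wl1 A x" using objective gap_sum_nonneg by fastforce
  next
    fix x assume x: "x \<in> box s \<and> A *v x = A *v xs \<and> wl1 A x \<le> wl1 A xs"
    then have "supp x \<subseteq> supp xs"
      using objective[of x] gap_sum_nonneg[of x] gap_nonneg slack
      by (intro supp_subset_if_gap_sum_zero) (auto simp: box_def)
    with x xs_box show "x = xs" by (auto intro: inj_onD[OF inj])
  qed
qed

end
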